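(* Linear network coding is sufficient to solve the 2-pair unicast problem: if a 2-pair unicast network $\mathcal{N}$ has a network coding solution, then it has a linear network coding solution.
   Context: Networks. A 2-pair unicast network consists of a finite directed acyclic graph $G=(V,E)$ with distinct nodes $s_1,s_2$ (sources) and $t_1,t_2$ (sinks), together with edge capacities. Each $s_i$ has exactly one out-edge $S(i)$ and no in-edge; each $t_i$ has exactly one in-edge $T(i)$ and no out-edge; every other node has at least one in-edge and one out-edge. The edges $S(i),T(i)$ are auxiliary edges attached to the original source $\hat s_i=head(S(i))$ and original sink $\hat t_i=tail(T(i))$, where $\hat s_i\ne\hat t_i$ and no edge joins some $s_i$ directly to some $t_j$. The edges $S(i)$ and $T(i)$ both have capacity equal to the maximum number of edge-disjoint paths from $\hat s_i$ to $\hat t_i$; all other edges have capacity $1$. An edge $e$ goes from $tail(e)$ to $head(e)$. Network coding. A network code consists of independent discrete random variables $X_1,X_2$ (the messages) with $H(X_1)=H(X_2)=1$ (entropy with respect to some chosen logarithm base) and functions $\{f_e: e\in E\}$ such that $X_{S(i)}=X_i$ for $i=1,2$, and $X_e=f_e\big((X_{e'})_{e'\in In(e)}\big)$ for every other edge $e$, where $In(e)=\{e': head(e')=tail(e)\}$, and such that $H(X_e)\le c(e)$ for each edge $e$, where $c(e)$ is the capacity. It is a network coding solution if $H(X_{S(i)}\mid X_{T(i)})=0$ for $i=1,2$. A network coding solution is linear if, for some finite field $\mathbb{F}_q$, the messages $X_1,X_2$ are independent and uniform on $\mathbb{F}_q$ (entropy taken to base $q$), every $X_e$ takes values in $\mathbb{F}_q$,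 and every $f_e$ is an $\mathbb{F}_q$-linear function of the symbols $(X_{e'})_{e'\in In(e)}$. *)

theory Defs
  imports
    "HOL-Probability.Information"
    "HOL-Algebra.Ring"
    "Graph_Theory.Arc_Walk"
begin

definition max_edge_disjoint_paths :: "('v, 'e) pre_digraph \<Rightarrow> 'v \<Rightarrow> 'v \<Rightarrow> nat" where
  "max_edge_disjoint_paths G u v =
     Max {card P |P. P \<subseteq> {p. pre_digraph.apath G u p v} \<and>
                     pairwise (\<lambda>p q. set p \<inter> set q = {}) P}"

text \<open>
  The two source-sink pairs are indexed by the natural numbers 1 and 2; the values of
  \<open>s\<close>, \<open>t\<close>, \<open>S\<close>, \<open>T\<close> elsewhere are irrelevant. The edge type of a digraph
  is separate from its vertex type, so parallel edges are allowed. The original source and sink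
  of pair \<open>i\<close> are \<open>head G (S i)\<close> and \<open>tail G (T i)\<close>.
\<close>

locale two_unicast_network = fin_digraph G
  for G :: "('v, 'e) pre_digraph" +
  fixes s t :: "nat \<Rightarrow> 'v" and S T :: "nat \<Rightarrow> 'e" and c :: "'e \<Rightarrow> nat"
  assumes acyclic: "acyclic (arcs_ends G)"
    and distinct_terminals: "distinct [s 1, s 2, t 1, t 2]"
    and terminals_in_verts: "{s 1, s 2, t 1, t 2} \<subseteq> verts G"
    and source: "i \<in> {1, 2} \<Longrightarrow> in_arcs G (s i) = {} \<and> out_arcs G (s i) = {S i}"
    and sink: "i \<in> {1, 2} \<Longrightarrow> in_arcs G (t i) = {T i} \<and> out_arcs G (t i) = {}"
    and inner: "v \<in> verts G - {s 1, s 2, t 1, t 2} \<Longrightarrow> in_arcs G v \<noteq> {} \<and> out_arcs G v \<noteq> {}"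
    and original_source_neq_sink: "i \<in> {1, 2} \<Longrightarrow> head G (S i) \<noteq> tail G (T i)"
    and no_direct_edge:
      "\<lbrakk>i \<in> {1, 2}; j \<in> {1, 2}; e \<in> arcs G\<rbrakk> \<Longrightarrow> \<not> (tail G e = s i \<and> head G e = t j)"
    and capacity_S:
      "i \<in> {1, 2} \<Longrightarrow> c (S i) = max_edge_disjoint_paths G (head G (S i)) (tail G (T i))"
    and capacity_T:
      "i \<in> {1, 2} \<Longrightarrow> c (T i) = max_edge_disjoint_paths G (head G (S i)) (tail G (T i))"
    and capacity_other: "e \<in> arcs G - {S 1, S 2, T 1, T 2} \<Longrightarrow> c e = 1"

text \<open>
  \<open>X i\<close> is the \<open>i\<close>-th message and \<open>Y e\<close> the symbol carried by edge \<open>e\<close>. All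
  symbols live in one type \<open>'x\<close>, into which the individual alphabets are embedded. Discreteness
  of a random variable means that its range is countable, possibly infinite.

  Restricting the argument of \<open>f e\<close> to the in-edges of the tail of \<open>e\<close> makes the
  symbol on \<open>e\<close> depend on nothing but the symbols on these edges.

  The entropies are those of the library. As these are defined by Bochner integrals, an infinite
  entropy would be read as 0; this cannot happen here, since the messages have entropy 1
  and every symbol is a function of the two messages.
\<close>

locale network_code = two_unicast_network G s t S T c + information_space M b
  for G :: "('v, 'e) pre_digraph" and s t S T c and M :: "'w measure" and b +
  fixes X :: "nat \<Rightarrow> 'w \<Rightarrow> 'x"
    and f :: "'e \<Rightarrow> ('e \<Rightarrow> 'x) \<Rightarrow> 'x"
    and Y :: "'e \<Rightarrow> 'w \<Rightarrow> 'x"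
  assumes message_measurable: "i \<in> {1, 2} \<Longrightarrow> random_variable (count_space UNIV) (X i)"
    and message_discrete: "i \<in> {1, 2} \<Longrightarrow> countable (X i ` space M)"
    and messages_indep: "indep_var (count_space UNIV) (X 1) (count_space UNIV) (X 2)"
    and message_entropy: "i \<in> {1, 2} \<Longrightarrow> \<H>(X i) = 1"
    and source_symbol: "\<lbrakk>i \<in> {1, 2}; \<omega> \<in> space M\<rbrakk> \<Longrightarrow> Y (S i) \<omega> = X i \<omega>"
    and edge_symbol: "\<lbrakk>e \<in> arcs G - {S 1, S 2}; \<omega> \<in> space M\<rbrakk> \<Longrightarrow>
      Y e \<omega> = f e (\<lambda>e'\<in>in_arcs G (tail G e). Y e' \<omega>)"
    and edge_capacity: "e \<in> arcs G \<Longrightarrow> \<H>(Y e) \<le> real (c e)"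

locale network_coding_solution = network_code +
  assumes decodable: "i \<in> {1, 2} \<Longrightarrow> \<H>(Y (S i) | Y (T i)) = 0"

definition linear_function :: "'x ring \<Rightarrow> 'e set \<Rightarrow> (('e \<Rightarrow> 'x) \<Rightarrow> 'x) \<Rightarrow> bool" where
  "linear_function F I g \<longleftrightarrow>
     (\<forall>x \<in> I \<rightarrow>\<^sub>E carrier F. g x \<in> carrier F) \<and>
     (\<forall>x \<in> I \<rightarrow>\<^sub>E carrier F. \<forall>y \<in> I \<rightarrow>\<^sub>E carrier F.
        g (\<lambda>e\<in>I. x e \<oplus>\<^bsub>F\<^esub> y e) = g x \<oplus>\<^bsub>F\<^esub> g y) \<and>
     (\<forall>a \<in> carrier F. \<forall>x \<in> I \<rightarrow>\<^sub>E carrier F.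
        g (\<lambda>e\<in>I. a \<otimes>\<^bsub>F\<^esub> x e) = a \<otimes>\<^bsub>F\<^esub> g x)"

locale linear_network_coding_solution =
  network_coding_solution G s t S T c M b X f Y
  for G :: "('v, 'e) pre_digraph" and s t S T c and M :: "'w measure" and b
    and X :: "nat \<Rightarrow> 'w \<Rightarrow> 'x" and f Y +
  fixes F :: "'x ring"
  assumes field: "field F"
    and finite_field: "finite (carrier F)"
    and base: "b = real (card (carrier F))"
    and message_uniform:
      "i \<in> {1, 2} \<Longrightarrow> distr M (count_space (carrier F)) (X i) = uniform_count_measure (carrier F)"
    and symbol_in_field: "\<lbrakk>e \<in> arcs G; \<omega> \<in> space M\<rbrakk> \<Longrightarrow> Y e \<omega> \<in> carrier F"
    and linear: "e \<in> arcs G - {S 1, S 2} \<Longrightarrow> linear_function F (in_arcs G (tail G e)) (f e)"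

end

theory Submission
  imports Defs "HOL-Number_Theory.Residues"
begin

text \<open>
  Say that an edge \<open>q\<close> dominates an edge \<open>e\<close> if every path from a source to \<open>e\<close> passes
  through \<open>q\<close>. In any solution, a unit capacity edge \<open>q\<close> that dominates \<open>T j\<close> cannot separate
  \<open>S i\<close> from \<open>T i\<close> for \<open>i \<noteq> j\<close>: the symbol on \<open>q\<close> would determine first \<open>X j\<close> and then, together
  with \<open>X j\<close>, also \<open>X i\<close>, so its entropy would be at least 2. Conversely, this condition suffices
  for a linear code over any sufficiently large prime field: the earliest dominators \<open>r i\<close> of
  \<open>T i\<close> carry \<open>X i\<close> itself; every other edge repeats the symbol on the edges entering its tail
  when these all agree, and otherwise carries a combination of the two messages in a direction of
  its own. A sink that cannot decode, or an edge \<open>r i\<close> that cannot obtain \<open>X i\<close>, sees a single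
  direction only, and the edge where that direction originates violates the condition.
\<close>

subsection \<open>Dominating edges and bottlenecks\<close>

context two_unicast_network
begin

lemma S_arc: "i \<in> {1,2} \<Longrightarrow> S i \<in> arcs G \<and> tail G (S i) = s i"
  using source[of i] by (auto simp: out_arcs_def)

lemma T_arc: "i \<in> {1,2} \<Longrightarrow> T i \<in> arcs G \<and> head G (T i) = t i"
  using sink[of i] by (auto simp: in_arcs_def)

lemma in_arcs_tail_S: "i \<in> {1,2} \<Longrightarrow> in_arcs G (tail G (S i)) = {}"
  using source S_arc by metis

lemma S_neq: "S 1 \<noteq> S 2"
  using S_arc[of 1] S_arc[of 2] distinct_terminals by auto

lemma T_neq: "T 1 \<noteq> T 2"
  using T_arc[of 1] T_arc[of 2] distinct_terminals by auto

lemma S_neq_T: "i \<in> {1,2} \<Longrightarrow> j \<in> {1,2} \<Longrightarrow> S i \<noteq> T j"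
  using S_arc[of i] T_arc[of j] no_direct_edge[of i j "S i"] by auto

lemma T_no_successor: "i \<in> {1,2} \<Longrightarrow> e \<in> arcs G \<Longrightarrow> tail G e \<noteq> head G (T i)"
  using sink[of i] T_arc[of i] by (auto simp: out_arcs_def)

lemma in_arcs_tail_nonempty:
  assumes "e \<in> arcs G" "e \<noteq> S 1" "e \<noteq> S 2"
  shows "in_arcs G (tail G e) \<noteq> {}"
proof -
  have "tail G e \<noteq> s i" if "i \<in> {1,2}" for i
    using source[OF that] assms that by (auto simp: out_arcs_def)
  moreover have "tail G e \<noteq> t i" if "i \<in> {1,2}" for i
    using sink[OF that] assms that by (auto simp: out_arcs_def)
  ultimately show ?thesis
    using inner[of "tail G e"] assms(1) by auto
qed

definition arc_rel :: "('e \<times> 'e) set" where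
  "arc_rel = {(e', e). e \<in> arcs G \<and> e' \<in> in_arcs G (tail G e)}"

text \<open>The tail of a predecessor is joined by an arc to the tail of the edge, so
  \<open>tail G\<close> maps \<open>arc_rel\<close> into the adjacency relation, which is
  well-founded because it is finite and acyclic.\<close>

lemma wf_arc_rel: "wf arc_rel"
proof -
  have "wf (arcs_ends G)"
    using acyclic by (intro finite_acyclic_wf) (auto simp: arcs_ends_def)
  then have "wf (inv_image (arcs_ends G) (tail G))"
    by (rule wf_inv_image)
  then show ?thesis
    by (rule wf_subset)
      (force simp: arc_rel_def arcs_ends_def arc_to_ends_def in_inv_image)
qed

lemma arc_induct [consumes 1, case_names arc]:
  assumes "e \<in> arcs G"
    and "\<And>e. e \<in> arcs G \<Longrightarrow> (\<And>e'. e' \<in> in_arcs G (tail G e) \<Longrightarrow> P e') \<Longrightarrow> P e"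
  shows "P e"
  using assms(1)
proof (induction e rule: wf_induct_rule[OF wf_arc_rel])
  case (1 e)
  show ?case
    by (rule assms(2)[OF \<open>e \<in> arcs G\<close>], rule "1.IH")
      (use "1.prems" in \<open>auto simp: arc_rel_def\<close>)
qed

lemma arc_rel_trancl_arcs: "(e', e) \<in> arc_rel\<^sup>+ \<Longrightarrow> e' \<in> arcs G \<and> e' \<noteq> T 1 \<and> e' \<noteq> T 2"
  by (induction rule: trancl_induct) (use T_no_successor in \<open>force simp: arc_rel_def\<close>)+

text \<open>Avoiding paths are encoded by the edges they can end in, with both ends counted as part
  of the path. A singleton \<open>Q\<close> expresses a cut by one edge.\<close>

inductive reaches :: "'e \<Rightarrow> 'e set \<Rightarrow> 'e \<Rightarrow> bool" for x Q where
  start: "x \<notin> Q \<Longrightarrow> reaches x Q x"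
| step: "reaches x Q e' \<Longrightarrow> e \<in> arcs G \<Longrightarrow> e' \<in> in_arcs G (tail G e) \<Longrightarrow> e \<notin> Q \<Longrightarrow> reaches x Q e"

lemma reaches_not_in: "reaches x Q e \<Longrightarrow> e \<notin> Q"
  by (induction rule: reaches.induct) auto

lemma reaches_avoids_start: "\<not> reaches x {x} e"
proof
  assume "reaches x {x} e"
  then show False by induction auto
qed

text \<open>A path avoiding \<open>Q\<close> cannot run through \<open>a\<close>, since its initial
  segment would already reach \<open>a\<close> outside \<open>Q\<close>.\<close>

lemma reaches_transfer: "reaches x Q b \<Longrightarrow> \<not> reaches x Q a \<Longrightarrow> reaches x {a} b"
proof (induction rule: reaches.induct)
  case start
  then show ?case by (auto intro: reaches.intros)
next
  case (step e' e)
  then have "e \<noteq> a" using reaches.step by blast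
  with step show ?case by (auto intro: reaches.intros)
qed

definition dominates :: "'e \<Rightarrow> 'e \<Rightarrow> bool" where
  "dominates q e \<longleftrightarrow> \<not> reaches (S 1) {q} e \<and> \<not> reaches (S 2) {q} e"

text \<open>Domination is asked of the predecessors to rule out the trivial dominator
  \<open>e\<close> itself. At \<open>S 1\<close> and \<open>S 2\<close>, which have no predecessors,
  it holds vacuously for every \<open>q\<close>; hence the side conditions in the lemmas
  below.\<close>

definition properly_dominates :: "'e \<Rightarrow> 'e \<Rightarrow> bool" where
  "properly_dominates q e \<longleftrightarrow> (\<forall>e'\<in>in_arcs G (tail G e). dominates q e')"

lemma dominatesD: "dominates q e \<Longrightarrow> i \<in> {1,2} \<Longrightarrow> \<not> reaches (S i) {q} e"
  by (auto simp: dominates_def)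

lemma dominates_refl: "dominates q q"
  using reaches_not_in by (fastforce simp: dominates_def)

lemma dominates_S: "i \<in> {1,2} \<Longrightarrow> dominates q (S i) \<Longrightarrow> q = S i"
  using reaches.start[of "S i" "{q}"] by (auto simp: dominates_def)

lemma dominates_step:
  assumes "dominates q e" "e \<in> arcs G" "e \<noteq> q"
  shows "properly_dominates q e"
  unfolding properly_dominates_def dominates_def
  using assms reaches.step[of _ "{q}" _ e] by (auto simp: dominates_def)

lemma not_reaches_if_preds:
  assumes "\<And>e'. e' \<in> in_arcs G (tail G e) \<Longrightarrow> \<not> reaches x Q e'" "e \<noteq> x"
  shows "\<not> reaches x Q e"
  using assms by (auto elim: reaches.cases)

lemma dominates_if_preds:
  assumes "properly_dominates q e" "e \<noteq> S 1" "e \<noteq> S 2"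
  shows "dominates q e"
  using assms not_reaches_if_preds[of e _ "{q}"]
  by (auto simp: dominates_def properly_dominates_def)

text \<open>A path to \<open>e\<close> around \<open>q'\<close> would also be a path around
  \<open>q\<close>, because \<open>q\<close> cannot be reached around \<open>q'\<close>.\<close>

lemma dominates_trans:
  assumes "dominates q' q" "dominates q e"
  shows "dominates q' e"
  using assms reaches_transfer[of _ "{q'}" e q] by (auto simp: dominates_def)

text \<open>Walking backwards from \<open>e\<close>, domination by \<open>q\<close> persists until
  \<open>q\<close> is met. The walk cannot run past \<open>q\<close> to another source, which is
  dominated by itself only.\<close>

lemma dominates_arc_rel:
  assumes "e \<in> arcs G" "dominates q e"
  shows "(q, e) \<in> arc_rel\<^sup>*"
  using assms
proof (induction e rule: arc_induct)
  case (arc e)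
  show ?case
  proof (cases "e = q")
    case False
    then have "properly_dominates q e" using arc.prems arc.hyps dominates_step by blast
    moreover have "e \<noteq> S 1" "e \<noteq> S 2" using False dominates_S arc.prems by blast+
    ultimately obtain e' where "e' \<in> in_arcs G (tail G e)" "dominates q e'"
      using in_arcs_tail_nonempty[OF arc.hyps] unfolding properly_dominates_def by blast
    with arc.IH arc.hyps show ?thesis
      by (auto simp: arc_rel_def intro: rtrancl_into_rtrancl)
  qed auto
qed

lemma properly_dominates_arc_rel:
  assumes "e \<in> arcs G" "e \<noteq> S 1" "e \<noteq> S 2" "properly_dominates q e"
  shows "(q, e) \<in> arc_rel\<^sup>+"
proof -
  obtain e' where "e' \<in> in_arcs G (tail G e)" "dominates q e'"
    using in_arcs_tail_nonempty assms unfolding properly_dominates_def by blast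
  with assms(1) dominates_arc_rel[of e' q] show ?thesis
    by (auto simp: arc_rel_def in_arcs_def intro: rtrancl_into_trancl1)
qed

text \<open>Take a proper dominator of \<open>e\<close> that is minimal for
  \<open>arc_rel\<^sup>+\<close>. A proper dominator of it would precede it and, by transitivity,
  properly dominate \<open>e\<close> as well.\<close>

lemma earliest_dominator:
  assumes e: "e \<in> arcs G" "e \<noteq> S 1" "e \<noteq> S 2" and "properly_dominates q0 e"
  obtains q where "properly_dominates q e"
    and "\<And>q'. q \<noteq> S 1 \<Longrightarrow> q \<noteq> S 2 \<Longrightarrow> \<not> properly_dominates q' q"
proof -
  obtain q where q: "properly_dominates q e"
    and min: "\<And>q'. (q', q) \<in> arc_rel\<^sup>+ \<Longrightarrow> \<not> properly_dominates q' e"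
    using wfE_min[OF wf_trancl[OF wf_arc_rel], of q0 "{q. properly_dominates q e}"] assms(4)
    by auto
  have "\<not> properly_dominates q' q" if "q \<noteq> S 1" "q \<noteq> S 2" for q'
  proof
    assume q': "properly_dominates q' q"
    have "q \<in> arcs G"
      using properly_dominates_arc_rel[OF e q] arc_rel_trancl_arcs by blast
    then have "(q', q) \<in> arc_rel\<^sup>+"
      using properly_dominates_arc_rel that q' by blast
    moreover have "properly_dominates q' e"
      using q dominates_if_preds[OF q' that] dominates_trans
      by (auto simp: properly_dominates_def)
    ultimately show False using min by blast
  qed
  with q that show thesis by blast
qed

end

text \<open>\<open>r i\<close> stands for the earliest proper dominator of \<open>T i\<close>, with
  \<open>S i\<close> as default if there is none. \<open>r_reaches\<close> is the separation
  condition that every solution enforces; the linear code is built from these assumptions and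
  positive capacities alone.\<close>

locale bottlenecks = two_unicast_network +
  fixes r :: "nat \<Rightarrow> 'b"
  assumes r_arc: "i \<in> {1,2} \<Longrightarrow> r i \<in> arcs G"
    and r_reaches: "i \<in> {1,2} \<Longrightarrow> j \<in> {1,2} \<Longrightarrow> i \<noteq> j \<Longrightarrow> reaches (S i) {r j} (T i)"
    and r_undominated: "i \<in> {1,2} \<Longrightarrow> r i \<noteq> S i \<Longrightarrow> \<not> properly_dominates q (r i)"
    and r_dominates: "i \<in> {1,2} \<Longrightarrow> properly_dominates (r i) (T i) \<or>
      r i = S i \<and> (\<forall>q. \<not> properly_dominates q (T i))"
begin

lemma not_reaches_S: "i \<in> {1,2} \<Longrightarrow> j \<in> {1,2} \<Longrightarrow> i \<noteq> j \<Longrightarrow> \<not> reaches (S i) Q (S j)"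
  using S_neq in_arcs_tail_S[of j] by (auto elim: reaches.cases)

lemma not_reaches_T: "i \<in> {1,2} \<Longrightarrow> \<not> reaches (S i) {r i} (T i)"
  using r_dominates[of i] dominates_if_preds[of "r i" "T i"] dominatesD[of "r i" "T i" i]
    S_neq_T[of _ i] reaches_avoids_start[of "S i"] by fastforce

lemma r_neq: "r 1 \<noteq> r 2"
  using r_reaches[of 1 2] not_reaches_T[of 1] by auto

lemma r_neq_S:
  assumes "i \<in> {1,2}" "j \<in> {1,2}" "i \<noteq> j"
  shows "r i \<noteq> S j"
proof
  assume "r i = S j"
  \<comment> \<open>No path from \<open>S i\<close> meets \<open>S j\<close>, so the path around
    \<open>r j\<close> also goes around \<open>S j\<close>, that is, around
    \<open>r i\<close>.\<close>
  moreover have "reaches (S i) {S j} (T i)"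
    using reaches_transfer[OF r_reaches[OF assms]] not_reaches_S[OF assms] by blast
  ultimately show False using not_reaches_T[OF assms(1)] by simp
qed

section \<open>Assignment of directions to edges\<close>

definition forced :: "'b set" where
  "forced = {S 1, S 2, r 1, r 2}"

text \<open>
  \<open>cls e\<close> is the edge at which the direction carried by \<open>e\<close> originates, where \<open>r i\<close> is identified
  with \<open>S i\<close>.
\<close>

definition cls :: "'b \<Rightarrow> 'b" where
  "cls = wfrec arc_rel (\<lambda>g e.
     if e \<in> {S 1, r 1} then S 1
     else if e \<in> {S 2, r 2} then S 2
     else if is_singleton (g ` in_arcs G (tail G e)) then the_elem (g ` in_arcs G (tail G e))
     else e)"

lemma cls_unfold:
  assumes "e \<in> arcs G"
  shows "cls e =
     (if e \<in> {S 1, r 1} then S 1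
      else if e \<in> {S 2, r 2} then S 2
      else if is_singleton (cls ` in_arcs G (tail G e)) then the_elem (cls ` in_arcs G (tail G e))
      else e)"
proof -
  have "cut cls arc_rel e ` in_arcs G (tail G e) = cls ` in_arcs G (tail G e)"
    using assms by (intro image_cong) (auto simp: cut_def arc_rel_def)
  then show ?thesis
    by (subst def_wfrec[OF eq_reflection[OF cls_def] wf_arc_rel]) (simp only:)
qed

lemma cls_forced: "i \<in> {1,2} \<Longrightarrow> e \<in> {S i, r i} \<Longrightarrow> cls e = S i"
  using cls_unfold[of e] S_arc[of i] r_arc[of i] S_neq r_neq r_neq_S[of 1 2] r_neq_S[of 2 1]
  by auto

lemma cls_inherit:
  assumes "e \<in> arcs G" "e \<notin> forced" "e' \<in> in_arcs G (tail G e)"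
    and "\<And>e''. e'' \<in> in_arcs G (tail G e) \<Longrightarrow> cls e'' = cls e'"
  shows "cls e = cls e'"
proof -
  have "cls ` in_arcs G (tail G e) = {cls e'}" using assms(3,4) by blast
  then show ?thesis using assms(2) by (simp add: cls_unfold[OF assms(1)] forced_def)
qed

lemma cls_fresh:
  assumes "e \<in> arcs G" "e \<notin> forced" "e\<^sub>1 \<in> in_arcs G (tail G e)" "e\<^sub>2 \<in> in_arcs G (tail G e)"
    and "cls e\<^sub>1 \<noteq> cls e\<^sub>2"
  shows "cls e = e"
proof -
  have "\<not> is_singleton (cls ` in_arcs G (tail G e))"
    using assms(3-5) by (metis imageI is_singleton_def singletonD)
  then show ?thesis using assms(2) by (simp add: cls_unfold[OF assms(1)] forced_def)
qed

lemma cls_cases: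
  assumes "e \<in> arcs G"
  obtains (forced) i where "i \<in> {1,2}" "e \<in> {S i, r i}" "cls e = S i"
  | (inherit) "e \<notin> forced" "\<And>e'. e' \<in> in_arcs G (tail G e) \<Longrightarrow> cls e' = cls e"
  | (fresh) e\<^sub>1 e\<^sub>2 where "e \<notin> forced" "cls e = e"
      "e\<^sub>1 \<in> in_arcs G (tail G e)" "e\<^sub>2 \<in> in_arcs G (tail G e)" "cls e\<^sub>1 \<noteq> cls e\<^sub>2"
proof (cases "e \<in> forced")
  case True
  then obtain i where "i \<in> {1,2}" "e \<in> {S i, r i}" by (auto simp: forced_def)
  with cls_forced that(1) show thesis by blast
next
  case False
  then show thesis
    using cls_inherit[OF assms False] cls_fresh[OF assms False] that(2,3) by metis
qed

lemma cls_arc: "e \<in> arcs G \<Longrightarrow> cls e \<in> arcs G"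
proof (induction e rule: arc_induct)
  case (arc e)
  from arc.hyps show ?case
  proof (cases rule: cls_cases)
    case inherit
    then show ?thesis
      using arc.IH in_arcs_tail_nonempty[OF arc.hyps] by (force simp: forced_def)
  qed (use arc.hyps S_arc in auto)
qed

text \<open>The direction \<open>S j\<close> starts only at \<open>S j\<close>, which
  \<open>S i\<close> does not reach, and at \<open>r j\<close>, which is avoided. Since inheriting
  it requires it on all predecessors, unreachability propagates forwards.\<close>

lemma cls_other_source:
  assumes ij: "i \<in> {1,2}" "j \<in> {1,2}" "i \<noteq> j" and "e \<in> arcs G" "cls e = S j"
  shows "\<not> reaches (S i) {r j} e"
  using assms(4,5)
proof (induction e rule: arc_induct)
  case (arc e)
  from arc.hyps show ?case
  proof (cases rule: cls_cases)
    case (forced k)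
    then have "k = j" using arc.prems S_neq ij by auto
    then show ?thesis
      using forced(2) not_reaches_S[OF ij] reaches_not_in[of "S i" "{r j}" e] by auto
  next
    case inherit
    have "\<not> reaches (S i) {r j} e'" if "e' \<in> in_arcs G (tail G e)" for e'
      using arc.IH[OF that] inherit(2)[OF that] arc.prems by metis
    moreover have "e \<noteq> S i" using inherit(1) ij by (auto simp: forced_def)
    ultimately show ?thesis using not_reaches_if_preds by blast
  next
    case fresh
    then show ?thesis using arc.prems ij by (auto simp: forced_def)
  qed
qed

text \<open>A fresh direction starts at a single edge and is inherited only from unanimous
  predecessors, so every path to \<open>e\<close> has passed its origin.\<close>

lemma cls_dominates:
  assumes "e \<in> arcs G" "cls e \<noteq> S 1" "cls e \<noteq> S 2"
  shows "dominates (cls e) e"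
  using assms
proof (induction e rule: arc_induct)
  case (arc e)
  from arc.hyps show ?case
  proof (cases rule: cls_cases)
    case (forced k)
    then show ?thesis using arc.prems by auto
  next
    case inherit
    then have "properly_dominates (cls e) e"
      using arc.IH arc.prems unfolding properly_dominates_def by metis
    then show ?thesis
      using inherit(1) by (intro dominates_if_preds) (auto simp: forced_def)
  next
    case fresh
    then show ?thesis using dominates_refl by metis
  qed
qed

text \<open>Behind \<open>r i\<close> no other forced edge interferes: \<open>S j\<close> is
  dominated by itself only, and \<open>r j\<close> has no proper dominator. So \<open>S i\<close> is
  inherited all the way from \<open>r i\<close>.\<close>

lemma cls_if_dominated:
  assumes i: "i \<in> {1,2}" and "e \<in> arcs G" "dominates (r i) e"
  shows "cls e = S i"
  using assms(2,3)
proof (induction e rule: arc_induct)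
  case (arc e)
  show ?case
  proof (cases "e \<in> {S i, r i}")
    case True
    then show ?thesis using cls_forced i by blast
  next
    case False
    have preds: "properly_dominates (r i) e"
      using dominates_step arc False by auto
    have not_S: "e \<noteq> S j" if "j \<in> {1,2}" "i \<noteq> j" for j
      using dominates_S[OF that(1), of "r i"] r_neq_S[OF i that] arc.prems by auto
    have not_r: "e \<noteq> r j" if "j \<in> {1,2}" "i \<noteq> j" for j
      using r_undominated[OF that(1)] preds not_S[OF that] by blast
    have "e \<notin> forced"
      using False i not_S[of 1] not_S[of 2] not_r[of 1] not_r[of 2] by (auto simp: forced_def)
    moreover from this obtain e' where "e' \<in> in_arcs G (tail G e)"
      using in_arcs_tail_nonempty[OF arc.hyps] unfolding forced_def by blast
    moreover have "cls e'' = S i" if "e'' \<in> in_arcs G (tail G e)" for e''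
      using arc.IH preds that unfolding properly_dominates_def by blast
    ultimately show ?thesis
      using cls_inherit[OF arc.hyps] by metis
  qed
qed

text \<open>Otherwise all edges entering the tail of \<open>e\<close> share one direction other than
  \<open>S i\<close>. If it is \<open>S j\<close>, then \<open>S i\<close> cannot reach
  \<open>e\<close> around \<open>r j\<close>; if it is fresh, its origin properly dominates
  \<open>e\<close>.\<close>

lemma encodable_message:
  assumes i: "i \<in> {1,2}" and e: "e \<in> arcs G" "e \<noteq> S 1" "e \<noteq> S 2"
    and "j \<in> {1,2}" "i \<noteq> j" "reaches (S i) {r j} e"
    and undominated: "\<And>q. \<not> properly_dominates q e"
  shows "\<exists>e\<^sub>1\<in>in_arcs G (tail G e). \<exists>e\<^sub>2\<in>in_arcs G (tail G e). cls e\<^sub>1 = S i \<or> cls e\<^sub>1 \<noteq> cls e\<^sub>2"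
proof (rule ccontr)
  assume contra: "\<not> ?thesis"
  obtain e\<^sub>1 where e\<^sub>1: "e\<^sub>1 \<in> in_arcs G (tail G e)"
    using in_arcs_tail_nonempty[OF e] by blast
  have all: "cls e' = cls e\<^sub>1" "e' \<in> arcs G" if "e' \<in> in_arcs G (tail G e)" for e'
    using contra e\<^sub>1 that by (blast, simp)
  have "cls e\<^sub>1 \<noteq> S i" using contra e\<^sub>1 by blast
  moreover have "cls e\<^sub>1 \<noteq> S j"
  proof
    assume "cls e\<^sub>1 = S j"
    then have "\<not> reaches (S i) {r j} e'" if "e' \<in> in_arcs G (tail G e)" for e'
      using all[OF that] cls_other_source[OF i assms(5,6)] by metis
    moreover have "e \<noteq> S i" using e i by auto
    ultimately show False using not_reaches_if_preds assms(7) by blast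
  qed
  ultimately have "cls e\<^sub>1 \<noteq> S 1" "cls e\<^sub>1 \<noteq> S 2" using i assms(5,6) by auto
  then have "properly_dominates (cls e\<^sub>1) e"
    using all cls_dominates by (metis properly_dominates_def)
  with undominated show False by blast
qed

lemma encodable_r:
  assumes i: "i \<in> {1,2}" and "r i \<noteq> S i"
  shows "\<exists>e\<^sub>1\<in>in_arcs G (tail G (r i)). \<exists>e\<^sub>2\<in>in_arcs G (tail G (r i)).
    cls e\<^sub>1 = S i \<or> cls e\<^sub>1 \<noteq> cls e\<^sub>2"
proof -
  obtain j where j: "j \<in> {1,2}" "i \<noteq> j" using i by force
  \<comment> \<open>The path from \<open>S i\<close> to \<open>T i\<close> around \<open>r j\<close>
    has to pass through \<open>r i\<close>; its initial segment is the one wanted.\<close>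
  have "reaches (S i) {r j} (r i)"
    using reaches_transfer[OF r_reaches[OF i j]] not_reaches_T[OF i] by blast
  then show ?thesis
    using r_undominated assms r_neq_S[OF i j] i j r_arc[OF i]
    by (intro encodable_message[OF i, of _ j]) auto
qed

lemma encodable_T:
  assumes i: "i \<in> {1,2}"
  shows "\<exists>e\<^sub>1\<in>in_arcs G (tail G (T i)). \<exists>e\<^sub>2\<in>in_arcs G (tail G (T i)).
    cls e\<^sub>1 = S i \<or> cls e\<^sub>1 \<noteq> cls e\<^sub>2"
proof (cases "properly_dominates (r i) (T i)")
  case True
  obtain e\<^sub>1 where "e\<^sub>1 \<in> in_arcs G (tail G (T i))"
    using in_arcs_tail_nonempty[of "T i"] T_arc[OF i] S_neq_T[of _ i] i by fastforce
  moreover from this True have "cls e\<^sub>1 = S i"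
    using cls_if_dominated[OF i, of e\<^sub>1] by (auto simp: properly_dominates_def)
  ultimately show ?thesis by blast
next
  case False
  obtain j where j: "j \<in> {1,2}" "i \<noteq> j" using i by force
  show ?thesis
    using r_dominates[OF i] False T_arc[OF i] S_neq_T[of 1 i] S_neq_T[of 2 i] i
      r_reaches[OF i j] j
    by (intro encodable_message[OF i, of _ j]) auto
qed

text \<open>The sink edges are overridden so that each carries its own message. They have no
  successors, so no other edge is affected.\<close>

definition label :: "'b \<Rightarrow> 'b" where
  "label e = (if e = T 1 then S 1 else if e = T 2 then S 2 else cls e)"

lemma label_arc: "e \<in> arcs G \<Longrightarrow> label e \<in> arcs G"
  using cls_arc S_arc by (auto simp: label_def)

lemma label_S: "i \<in> {1,2} \<Longrightarrow> label (S i) = S i"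
  using S_neq_T[of i 1] S_neq_T[of i 2] cls_forced by (auto simp: label_def)

lemma label_T: "i \<in> {1,2} \<Longrightarrow> label (T i) = S i"
  using T_neq by (auto simp: label_def)

text \<open>The two alternatives are the two ways to encode: copy one incoming symbol, or combine
  two that have different directions and therefore determine both messages.\<close>

lemma encodable_label:
  assumes e: "e \<in> arcs G" "e \<noteq> S 1" "e \<noteq> S 2"
  shows "\<exists>e\<^sub>1\<in>in_arcs G (tail G e). \<exists>e\<^sub>2\<in>in_arcs G (tail G e).
    label e\<^sub>1 = label e \<or> label e\<^sub>1 \<noteq> label e\<^sub>2"
proof -
  have label_in: "label e' = cls e'" if "e' \<in> in_arcs G (tail G e)" for e'
    using that T_no_successor[OF _ e(1)] by (force simp: label_def)
  have "\<exists>e\<^sub>1\<in>in_arcs G (tail G e). \<exists>e\<^sub>2\<in>in_arcs G (tail G e). cls e\<^sub>1 = label e \<or> cls e\<^sub>1 \<noteq> cls e\<^sub>2"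
  proof (cases "e = T 1 \<or> e = T 2")
    case True
    then obtain i where i: "i \<in> {1,2}" "e = T i" by auto
    then show ?thesis using encodable_T[OF i(1)] label_T[OF i(1)] by metis
  next
    case False
    then have "label e = cls e" by (simp add: label_def)
    from e(1) show ?thesis
    proof (cases rule: cls_cases)
      case (forced i)
      then show ?thesis
        using encodable_r[of i] e \<open>label e = cls e\<close> by auto
    next
      case inherit
      then show ?thesis
        using in_arcs_tail_nonempty[OF e] \<open>label e = cls e\<close> by (metis ex_in_conv)
    next
      case fresh
      then show ?thesis by blast
    qed
  qed
  then show ?thesis using label_in by metis
qed

end

subsection \<open>Entropies of discrete variables\<close>

definition (in prob_space) discrete_variable :: "('a \<Rightarrow> 'b) \<Rightarrow> bool" where
  "discrete_variable Z \<longleftrightarrow> random_variable (count_space UNIV) Z \<and> countable (Z ` space M)"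

text \<open>As a function of the outcome, its negative logarithm is the information content of
  \<open>Z\<close>, whose mean is the entropy. Entropies can thus be compared pointwise almost
  everywhere.\<close>

definition (in prob_space) atom_prob :: "('a \<Rightarrow> 'b) \<Rightarrow> 'a \<Rightarrow> real" where
  "atom_prob Z \<omega> = prob (Z -` {Z \<omega>} \<inter> space M)"

context prob_space
begin

lemma discrete_variable_sets: "discrete_variable Z \<Longrightarrow> Z -` A \<inter> space M \<in> events"
  by (auto simp: discrete_variable_def intro: measurable_sets)

lemma discrete_variable_determined:
  assumes U: "discrete_variable U"
    and det: "\<And>\<omega> \<omega>'. \<omega> \<in> space M \<Longrightarrow> \<omega>' \<in> space M \<Longrightarrow> U \<omega> = U \<omega>' \<Longrightarrow> V \<omega> = V \<omega>'"
  shows "discrete_variable V"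
proof -
  have "V -` A \<inter> space M \<in> events" for A
  proof -
    have "V -` A \<inter> space M = U -` (U ` (V -` A \<inter> space M)) \<inter> space M"
      using det by auto
    then show ?thesis using discrete_variable_sets[OF U] by metis
  qed
  \<comment> \<open>\<open>V\<close> factors through \<open>U\<close>: \<open>inv_into\<close> picks
    some outcome with the given value of \<open>U\<close>.\<close>
  moreover have "V ` space M = (\<lambda>u. V (inv_into (space M) U u)) ` (U ` space M)"
    using det[OF inv_into_into[of _ U "space M"] _ f_inv_into_f[of _ U "space M"]]
    by (force simp: image_image)
  then have "countable (V ` space M)"
    using U by (auto simp: discrete_variable_def)
  ultimately show ?thesis
    by (auto simp: discrete_variable_def intro!: measurableI)
qed

lemma discrete_variable_Pair:
  assumes "discrete_variable U" "discrete_variable V"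
  shows "discrete_variable (\<lambda>\<omega>. (U \<omega>, V \<omega>))"
proof -
  let ?C = "U ` space M \<times> V ` space M"
  have count: "countable ?C"
    using assms by (auto simp: discrete_variable_def)
  have "(\<lambda>\<omega>. (U \<omega>, V \<omega>)) \<in> M \<rightarrow>\<^sub>M count_space ?C"
  proof (subst measurable_count_space_eq_countable[OF count], intro conjI ballI)
    fix z assume "z \<in> ?C"
    have "(\<lambda>\<omega>. (U \<omega>, V \<omega>)) -` {z} \<inter> space M = (U -` {fst z} \<inter> space M) \<inter> (V -` {snd z} \<inter> space M)"
      by auto
    then show "(\<lambda>\<omega>. (U \<omega>, V \<omega>)) -` {z} \<inter> space M \<in> events"
      using sets.Int[OF discrete_variable_sets[OF assms(1)] discrete_variable_sets[OF assms(2)]]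
      by metis
  qed auto
  then have "(\<lambda>\<omega>. (U \<omega>, V \<omega>)) \<in> M \<rightarrow>\<^sub>M count_space UNIV"
    by (rule measurable_compose) auto
  moreover have "countable ((\<lambda>\<omega>. (U \<omega>, V \<omega>)) ` space M)"
    by (rule countable_subset[OF _ count]) auto
  ultimately show ?thesis by (simp add: discrete_variable_def)
qed

lemma distributed_count_space:
  assumes Z: "discrete_variable Z" and A: "countable A" "Z ` space M \<subseteq> A"
  shows "distributed M (count_space A) Z (\<lambda>z. ennreal (prob (Z -` {z} \<inter> space M)))"
  unfolding distributed_def
proof safe
  have meas: "Z \<in> M \<rightarrow>\<^sub>M count_space A"
    using discrete_variable_sets[OF Z] A
    by (subst measurable_count_space_eq_countable) auto
  then show "random_variable (count_space A) Z" .
  show "distr M (count_space A) Z = density (count_space A) (\<lambda>z. ennreal (prob (Z -` {z} \<inter> space M)))"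
  proof (rule measure_eqI_countable[OF _ _ A(1)])
    fix a assume "a \<in> A"
    then show "emeasure (distr M (count_space A) Z) {a} =
        emeasure (density (count_space A) (\<lambda>z. ennreal (prob (Z -` {z} \<inter> space M)))) {a}"
      using meas
      by (simp add: emeasure_distr emeasure_density emeasure_eq_measure nn_integral_indicator_singleton')
  qed auto
qed auto

lemma atom_prob_measurable [measurable]:
  assumes "discrete_variable Z"
  shows "atom_prob Z \<in> borel_measurable M"
  unfolding atom_prob_def
  by (rule measurable_compose[of Z M "count_space UNIV"])
    (use assms in \<open>auto simp: discrete_variable_def\<close>)

lemma atom_prob_le_1: "atom_prob Z \<omega> \<le> 1"
  by (simp add: atom_prob_def)

text \<open>The exceptional outcomes lie in countably many null atoms.\<close>

lemma AE_atom_prob_pos: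
  assumes Z: "discrete_variable Z"
  shows "AE \<omega> in M. 0 < atom_prob Z \<omega>"
proof -
  have "AE \<omega> in M. prob (Z -` {z} \<inter> space M) = 0 \<longrightarrow> Z \<omega> \<noteq> z" for z
  proof (cases "prob (Z -` {z} \<inter> space M) = 0")
    case True
    then show ?thesis
      using discrete_variable_sets[OF Z, of "{z}"]
      by (intro AE_I[of _ _ "Z -` {z} \<inter> space M"]) (auto simp: emeasure_eq_measure)
  qed auto
  then have "AE \<omega> in M. \<forall>z\<in>Z ` space M. prob (Z -` {z} \<inter> space M) = 0 \<longrightarrow> Z \<omega> \<noteq> z"
    using Z by (subst AE_ball_countable) (auto simp: discrete_variable_def)
  then show ?thesis
    using AE_space by eventually_elim (auto simp: atom_prob_def zero_less_measure_iff)
qed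

lemma atom_prob_mono:
  assumes "discrete_variable V" "\<omega> \<in> space M"
    and "\<And>\<omega>'. \<omega>' \<in> space M \<Longrightarrow> U \<omega>' = U \<omega> \<Longrightarrow> V \<omega>' = V \<omega>"
  shows "atom_prob U \<omega> \<le> atom_prob V \<omega>"
  unfolding atom_prob_def
  using assms(3) by (intro finite_measure_mono discrete_variable_sets[OF assms(1)]) blast

lemma atom_prob_cong:
  assumes "\<omega> \<in> space M" "\<And>\<omega>'. \<omega>' \<in> space M \<Longrightarrow> U \<omega>' = U \<omega> \<longleftrightarrow> V \<omega>' = V \<omega>"
  shows "atom_prob U \<omega> = atom_prob V \<omega>"
  unfolding atom_prob_def using assms by (intro arg_cong[where f = prob]) auto

end

context information_space
begin

lemma entropy_eq_expectation:
  assumes Z: "discrete_variable Z"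
  shows "\<H>(Z) = expectation (\<lambda>\<omega>. - log b (atom_prob Z \<omega>))"
proof -
  let ?f = "\<lambda>z. prob (Z -` {z} \<inter> space M)"
  have dist: "distributed M (count_space (Z ` space M)) Z (\<lambda>z. ennreal (?f z))"
    using Z by (intro distributed_count_space) (auto simp: discrete_variable_def)
  have "\<H>(Z) = - (\<integral>z. ?f z * log b (?f z) \<partial>count_space (Z ` space M))"
    by (rule entropy_distr[OF dist]) simp
  also have "(\<integral>z. ?f z * log b (?f z) \<partial>count_space (Z ` space M)) = expectation (\<lambda>\<omega>. log b (?f (Z \<omega>)))"
    by (rule distributed_integral[OF dist]) auto
  finally show ?thesis by (simp add: atom_prob_def)
qed

lemma conditional_entropy_eq_expectation:
  assumes X: "discrete_variable X" and Y: "discrete_variable Y"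
  shows "\<H>(X | Y) =
    expectation (\<lambda>\<omega>. - log b (atom_prob (\<lambda>\<omega>. (X \<omega>, Y \<omega>)) \<omega> / atom_prob Y \<omega>))"
proof -
  let ?A = "X ` space M" and ?B = "Y ` space M"
  let ?XY = "\<lambda>\<omega>. (X \<omega>, Y \<omega>)"
  let ?g = "\<lambda>y. prob (Y -` {y} \<inter> space M)" and ?f = "\<lambda>z. prob (?XY -` {z} \<inter> space M)"
  have count: "countable ?A" "countable ?B"
    using X Y by (auto simp: discrete_variable_def)
  have prod: "count_space ?A \<Otimes>\<^sub>M count_space ?B = count_space (?A \<times> ?B)"
    using count by (rule pair_measure_countable)
  have distY: "distributed M (count_space ?B) Y (\<lambda>y. ennreal (?g y))"
    using Y count by (intro distributed_count_space) auto
  have distXY: "distributed M (count_space ?A \<Otimes>\<^sub>M count_space ?B) ?XY (\<lambda>z. ennreal (?f z))"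
    unfolding prod using count X Y
    by (intro distributed_count_space discrete_variable_Pair) auto
  have "\<H>(X | Y) = - (\<integral>(x, y). ?f (x, y) * log b (?f (x, y) / ?g y) \<partial>(count_space ?A \<Otimes>\<^sub>M count_space ?B))"
    using count
    by (intro conditional_entropy_generic_eq[OF _ _ distY _ distXY] sigma_finite_measure_count_space_countable) auto
  also have "(\<integral>(x, y). ?f (x, y) * log b (?f (x, y) / ?g y) \<partial>(count_space ?A \<Otimes>\<^sub>M count_space ?B)) =
      (\<integral>z. ?f z * log b (?f z / ?g (snd z)) \<partial>(count_space ?A \<Otimes>\<^sub>M count_space ?B))"
    by (simp add: case_prod_unfold)
  also have "\<dots> = expectation (\<lambda>\<omega>. log b (?f (?XY \<omega>) / ?g (snd (?XY \<omega>))))"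
    by (rule distributed_integral[OF distXY]) (auto simp: prod)
  finally show ?thesis by (simp add: atom_prob_def)
qed

text \<open>The conditional information content is almost everywhere nonnegative, so a zero mean
  makes it vanish. The majorant \<open>D\<close> ensures that this mean is a genuine integral and
  not the default 0.\<close>

lemma conditional_entropy_eq_0_imp:
  assumes X: "discrete_variable X" and Y: "discrete_variable Y" and "\<H>(X | Y) = 0"
    and D: "integrable M D"
    and bound: "AE \<omega> in M. - log b (atom_prob (\<lambda>\<omega>. (X \<omega>, Y \<omega>)) \<omega> / atom_prob Y \<omega>) \<le> D \<omega>"
  shows "AE \<omega> in M. atom_prob (\<lambda>\<omega>. (X \<omega>, Y \<omega>)) \<omega> = atom_prob Y \<omega>"
proof -
  let ?XY = "\<lambda>\<omega>. (X \<omega>, Y \<omega>)"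
  let ?h = "\<lambda>\<omega>. - log b (atom_prob ?XY \<omega> / atom_prob Y \<omega>)"
  note XY = discrete_variable_Pair[OF X Y]
  have meas: "?h \<in> borel_measurable M"
    using atom_prob_measurable[OF XY] atom_prob_measurable[OF Y] by measurable
  have pos: "AE \<omega> in M. 0 < atom_prob ?XY \<omega> \<and> atom_prob ?XY \<omega> \<le> atom_prob Y \<omega>"
    using AE_atom_prob_pos[OF XY] AE_space
    by eventually_elim (auto intro: atom_prob_mono[OF Y])
  then have nonneg: "AE \<omega> in M. 0 \<le> ?h \<omega>"
    by eventually_elim (use b_gt_1 in \<open>auto simp: field_simps\<close>)
  have "integrable M ?h"
  proof (rule Bochner_Integration.integrable_bound[OF D meas])
    show "AE \<omega> in M. norm (?h \<omega>) \<le> norm (D \<omega>)"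
      using bound nonneg by eventually_elim auto
  qed
  then have "AE \<omega> in M. ?h \<omega> = 0"
    using integral_nonneg_eq_0_iff_AE[OF _ nonneg] assms(3) conditional_entropy_eq_expectation[OF X Y]
    by simp
  with pos show ?thesis
    by eventually_elim (use b_gt_1 in \<open>auto simp: log_def\<close>)
qed

end

section \<open>Symbols as functions of the messages\<close>

context network_code
begin

text \<open>Cut-set argument by induction along the edges: only symbols on \<open>Q\<close> and
  messages that arrive around \<open>Q\<close> can influence \<open>Y e\<close>. The local form of
  the code enters later arguments through this lemma.\<close>

lemma symbol_determined:
  assumes "e \<in> arcs G" and \<omega>: "\<omega> \<in> space M" "\<omega>' \<in> space M"
    and Q: "\<And>q. q \<in> Q \<Longrightarrow> Y q \<omega> = Y q \<omega>'"
    and "\<And>i. i \<in> {1,2} \<Longrightarrow> reaches (S i) Q e \<Longrightarrow> X i \<omega> = X i \<omega>'"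
  shows "Y e \<omega> = Y e \<omega>'"
  using assms(1,5)
proof (induction e rule: arc_induct)
  case (arc e)
  consider "e \<in> Q" | i where "e \<notin> Q" "i \<in> {1,2}" "e = S i" | "e \<notin> Q" "e \<notin> {S 1, S 2}"
    by blast
  then show ?case
  proof cases
    case (2 i)
    then show ?thesis
      using arc.prems[of i] \<omega> source_symbol[of i] reaches.start[of "S i" Q] by auto
  next
    case 3
    have "Y e' \<omega> = Y e' \<omega>'" if "e' \<in> in_arcs G (tail G e)" for e'
      using arc.IH[OF that] arc.prems reaches.step[OF _ arc.hyps that 3(1)] by blast
    then have "(\<lambda>e'\<in>in_arcs G (tail G e). Y e' \<omega>) = (\<lambda>e'\<in>in_arcs G (tail G e). Y e' \<omega>')"
      by (rule restrict_ext)
    then show ?thesis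
      using 3 arc.hyps \<omega> edge_symbol by (metis DiffI)
  qed (rule Q)
qed

lemma message_discrete_variable: "i \<in> {1,2} \<Longrightarrow> discrete_variable (X i)"
  using message_measurable message_discrete by (simp add: discrete_variable_def)

lemma AE_message_prob_pos: "AE \<omega> in M. 0 < atom_prob (X 1) \<omega> \<and> 0 < atom_prob (X 2) \<omega>"
  by (intro AE_conjI AE_atom_prob_pos message_discrete_variable) auto

lemma messages_discrete_variable: "discrete_variable (\<lambda>\<omega>. (X 1 \<omega>, X 2 \<omega>))"
  by (intro discrete_variable_Pair message_discrete_variable) auto

lemma symbol_determined_by_messages:
  assumes "e \<in> arcs G" "\<omega> \<in> space M" "\<omega>' \<in> space M"
    and "(X 1 \<omega>, X 2 \<omega>) = (X 1 \<omega>', X 2 \<omega>')"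
  shows "Y e \<omega> = Y e \<omega>'"
  using assms by (intro symbol_determined[of e \<omega> \<omega>' "{}"]) auto

lemma symbol_discrete_variable: "e \<in> arcs G \<Longrightarrow> discrete_variable (Y e)"
  using discrete_variable_determined[OF messages_discrete_variable] symbol_determined_by_messages
  by blast

lemma prob_messages:
  assumes "i \<in> {1,2}" "j \<in> {1,2}" "i \<noteq> j"
  shows "prob ((X i -` A \<inter> space M) \<inter> (X j -` B \<inter> space M)) =
    prob (X i -` A \<inter> space M) * prob (X j -` B \<inter> space M)"
proof -
  have "prob ((X 1 -` A \<inter> space M) \<inter> (X 2 -` B \<inter> space M)) =
    prob (X 1 -` A \<inter> space M) * prob (X 2 -` B \<inter> space M)" for A B
  proof -
    have "(\<lambda>x. (X 1 x, X 2 x)) -` (A \<times> B) \<inter> space M = (X 1 -` A \<inter> space M) \<inter> (X 2 -` B \<inter> space M)"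
      by auto
    then show ?thesis
      using indep_varD[OF messages_indep, of A B] by simp
  qed
  then show ?thesis using assms by (auto simp: mult.commute Int_commute)
qed

lemma atom_prob_messages:
  assumes "i \<in> {1,2}" "j \<in> {1,2}" "i \<noteq> j"
  shows "prob ((X i -` {X i \<omega>} \<inter> space M) \<inter> (X j -` {X j \<omega>} \<inter> space M)) =
    atom_prob (X i) \<omega> * atom_prob (X j) \<omega>"
  using prob_messages[OF assms] by (simp add: atom_prob_def)

text \<open>
  Besides giving the value 2 in the entropy bound, this is an integrable majorant for the
  information content of every symbol. It excludes that an entropy is 0 only because the
  Bochner integral of a non-integrable function is 0.
\<close>

definition message_information :: "'w \<Rightarrow> real" where
  "message_information \<omega> = - log b (atom_prob (X 1) \<omega> * atom_prob (X 2) \<omega>)"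

lemma message_information:
  shows integrable_message_information: "integrable M message_information"
    and expectation_message_information: "expectation message_information = 2"
proof -
  have H: "expectation (\<lambda>\<omega>. - log b (atom_prob (X i) \<omega>)) = 1" if "i \<in> {1,2}" for i
    using message_entropy[OF that] entropy_eq_expectation[OF message_discrete_variable[OF that]]
    by simp
  \<comment> \<open>A non-integrable function would have integral 0, whereas this one has integral
    1.\<close>
  have I: "integrable M (\<lambda>\<omega>. - log b (atom_prob (X i) \<omega>))" if "i \<in> {1,2}" for i
    using H[OF that] not_integrable_integral_eq by fastforce
  have [measurable]: "atom_prob (X 1) \<in> borel_measurable M" "atom_prob (X 2) \<in> borel_measurable M"
    by (intro atom_prob_measurable message_discrete_variable; simp)+
  have [measurable]: "message_information \<in> borel_measurable M"
    unfolding message_information_def by measurable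
  have eq: "AE \<omega> in M. - log b (atom_prob (X 1) \<omega>) + - log b (atom_prob (X 2) \<omega>) = message_information \<omega>"
    using AE_message_prob_pos by eventually_elim (simp add: message_information_def log_mult)
  have sum: "integrable M (\<lambda>\<omega>. - log b (atom_prob (X 1) \<omega>) + - log b (atom_prob (X 2) \<omega>))"
    using I[of 1] I[of 2] by (intro Bochner_Integration.integrable_add) auto
  show "integrable M message_information"
    using sum eq by (subst integrable_cong_AE[symmetric, OF _ _ eq]) auto
  have "expectation message_information =
      expectation (\<lambda>\<omega>. - log b (atom_prob (X 1) \<omega>) + - log b (atom_prob (X 2) \<omega>))"
    using eq sum by (intro integral_cong_AE) auto
  also have "\<dots> = 2"
    using I[of 1] I[of 2] H[of 1] H[of 2] by (subst Bochner_Integration.integral_add) auto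
  finally show "expectation message_information = 2" .
qed

text \<open>The atom of \<open>V\<close> contains the joint atom of the two messages, whose
  probability is a product by independence.\<close>

lemma information_le_message_information:
  assumes V: "discrete_variable V"
    and det: "\<And>\<omega> \<omega>'. \<omega> \<in> space M \<Longrightarrow> \<omega>' \<in> space M \<Longrightarrow> X 1 \<omega> = X 1 \<omega>' \<Longrightarrow> X 2 \<omega> = X 2 \<omega>' \<Longrightarrow> V \<omega> = V \<omega>'"
  shows "AE \<omega> in M. - log b (atom_prob V \<omega>) \<le> message_information \<omega>"
proof -
  have le: "atom_prob (X 1) \<omega> * atom_prob (X 2) \<omega> \<le> atom_prob V \<omega>" if "\<omega> \<in> space M" for \<omega>
    using det[OF _ that] atom_prob_messages[of 1 2 \<omega>] discrete_variable_sets[OF V]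
    unfolding atom_prob_def[of V] by (auto intro!: finite_measure_mono simp flip: atom_prob_messages)
  show ?thesis
    using AE_space AE_message_prob_pos AE_atom_prob_pos[OF V]
  proof eventually_elim
    case (elim \<omega>)
    then show ?case
      using b_gt_1 le[OF elim(1)] by (simp add: message_information_def log_le_cancel_iff)
  qed
qed

end

section \<open>Separation conditions enforced by a solution\<close>

context network_coding_solution
begin

text \<open>Zero conditional entropy in pointwise form: adding \<open>X i\<close> does not refine
  the atoms of \<open>Y (T i)\<close>, up to null sets.\<close>

lemma AE_decodable:
  assumes i: "i \<in> {1,2}"
  shows "AE \<omega> in M. atom_prob (\<lambda>\<omega>. (X i \<omega>, Y (T i) \<omega>)) \<omega> = atom_prob (Y (T i)) \<omega>"
proof -
  note TX = symbol_discrete_variable[of "T i"] message_discrete_variable[OF i]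
  have T: "discrete_variable (Y (T i))" using TX(1) T_arc[OF i] by blast
  note XY = discrete_variable_Pair[OF TX(2) T]
  have "\<H>(Y (S i) | Y (T i)) = \<H>(X i | Y (T i))"
  proof -
    have S: "discrete_variable (Y (S i))" using S_arc[OF i] symbol_discrete_variable by blast
    have "\<H>(Y (S i) | Y (T i)) = expectation (\<lambda>\<omega>. - log b (atom_prob (\<lambda>\<omega>. (Y (S i) \<omega>, Y (T i) \<omega>)) \<omega> / atom_prob (Y (T i)) \<omega>))"
      by (rule conditional_entropy_eq_expectation[OF S T])
    also have "\<dots> = expectation (\<lambda>\<omega>. - log b (atom_prob (\<lambda>\<omega>. (X i \<omega>, Y (T i) \<omega>)) \<omega> / atom_prob (Y (T i)) \<omega>))"
    proof (rule Bochner_Integration.integral_cong[OF refl])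
      fix \<omega> assume "\<omega> \<in> space M"
      then have "atom_prob (\<lambda>\<omega>. (Y (S i) \<omega>, Y (T i) \<omega>)) \<omega> = atom_prob (\<lambda>\<omega>. (X i \<omega>, Y (T i) \<omega>)) \<omega>"
        using source_symbol[OF i] by (intro atom_prob_cong) auto
      then show "- log b (atom_prob (\<lambda>\<omega>. (Y (S i) \<omega>, Y (T i) \<omega>)) \<omega> / atom_prob (Y (T i)) \<omega>) =
        - log b (atom_prob (\<lambda>\<omega>. (X i \<omega>, Y (T i) \<omega>)) \<omega> / atom_prob (Y (T i)) \<omega>)" by simp
    qed
    also have "\<dots> = \<H>(X i | Y (T i))"
      by (rule conditional_entropy_eq_expectation[OF TX(2) T, symmetric])
    finally show ?thesis .
  qed
  then have zero: "\<H>(X i | Y (T i)) = 0" using decodable[OF i] by simp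
  have "AE \<omega> in M. - log b (atom_prob (\<lambda>\<omega>. (X i \<omega>, Y (T i) \<omega>)) \<omega>) \<le> message_information \<omega>"
  proof (rule information_le_message_information[OF XY])
    fix \<omega> \<omega>' assume *: "\<omega> \<in> space M" "\<omega>' \<in> space M" "X 1 \<omega> = X 1 \<omega>'" "X 2 \<omega> = X 2 \<omega>'"
    then have "Y (T i) \<omega> = Y (T i) \<omega>'"
      using T_arc[OF i] symbol_determined_by_messages by blast
    with * i show "(X i \<omega>, Y (T i) \<omega>) = (X i \<omega>', Y (T i) \<omega>')" by auto
  qed
  \<comment> \<open>Dividing by a probability, which is at most 1, can only lower the information
    content, so the majorant for the pair still works.\<close>
  then have "AE \<omega> in M. - log b (atom_prob (\<lambda>\<omega>. (X i \<omega>, Y (T i) \<omega>)) \<omega> / atom_prob (Y (T i)) \<omega>) \<le> message_information \<omega>"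
    using AE_atom_prob_pos[OF T] AE_atom_prob_pos[OF XY]
  proof eventually_elim
    case (elim \<omega>)
    have "log b (atom_prob (Y (T i)) \<omega>) \<le> 0"
      using elim(2) b_gt_1 atom_prob_le_1 by simp
    moreover have "log b (atom_prob (\<lambda>\<omega>. (X i \<omega>, Y (T i) \<omega>)) \<omega> / atom_prob (Y (T i)) \<omega>) =
        log b (atom_prob (\<lambda>\<omega>. (X i \<omega>, Y (T i) \<omega>)) \<omega>) - log b (atom_prob (Y (T i)) \<omega>)"
      using elim(2,3) by (simp add: log_divide)
    ultimately show ?case using elim(1) by linarith
  qed
  with zero show ?thesis
    by (intro conditional_entropy_eq_0_imp[OF TX(2) T _ integrable_message_information]) auto
qed

lemma decoding_error_null:
  assumes i: "i \<in> {1,2}"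
    and eq: "atom_prob (\<lambda>\<omega>. (X i \<omega>, Y (T i) \<omega>)) \<omega> = atom_prob (Y (T i)) \<omega>"
  shows "(Y (T i) -` {Y (T i) \<omega>} \<inter> space M) - (X i -` {X i \<omega>} \<inter> space M) \<in> null_sets M"
proof -
  have T: "discrete_variable (Y (T i))" using symbol_discrete_variable T_arc[OF i] by blast
  let ?A = "X i -` {X i \<omega>} \<inter> space M" and ?B = "Y (T i) -` {Y (T i) \<omega>} \<inter> space M"
  have ev: "?A \<in> events" "?B \<in> events"
    using discrete_variable_sets[OF T] discrete_variable_sets[OF message_discrete_variable[OF i]] by auto
  have "?A \<inter> ?B = (\<lambda>\<omega>. (X i \<omega>, Y (T i) \<omega>)) -` {(X i \<omega>, Y (T i) \<omega>)} \<inter> space M" by auto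
  then have "prob (?A \<inter> ?B) = prob ?B" using eq by (simp add: atom_prob_def)
  then have "prob (?B - ?A) = 0"
    using finite_measure_Diff'[OF ev(2,1)] by (simp add: Int_commute)
  with ev show ?thesis by (auto simp: null_sets_def emeasure_eq_measure)
qed

text \<open>Otherwise \<open>Y (T i)\<close> depends on \<open>X j\<close> only and is independent
  of \<open>X i\<close>. Decodability then makes \<open>X i\<close> almost surely constant, against
  its entropy 1.\<close>

lemma reaches_own_sink:
  assumes ij: "i \<in> {1,2}" "j \<in> {1,2}" "i \<noteq> j"
  shows "reaches (S i) {S j} (T i)"
proof (rule ccontr)
  assume not: "\<not> ?thesis"
  have T: "T i \<in> arcs G" "discrete_variable (Y (T i))"
    using symbol_discrete_variable T_arc[OF ij(1)] by auto
  note X = message_discrete_variable[OF ij(1)]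
  have det: "Y (T i) \<omega> = Y (T i) \<omega>'" if "\<omega> \<in> space M" "\<omega>' \<in> space M" "X j \<omega> = X j \<omega>'" for \<omega> \<omega>'
    using that not source_symbol[OF ij(2)] ij reaches_avoids_start
    by (intro symbol_determined[OF T(1), of _ _ "{S j}"]) auto
  have "AE \<omega> in M. atom_prob (X i) \<omega> = 1"
    using AE_decodable[OF ij(1)] AE_atom_prob_pos[OF T(2)] AE_space
  proof eventually_elim
    case (elim \<omega>)
    let ?B = "Y (T i) -` {Y (T i) \<omega>} \<inter> space M"
    \<comment> \<open>The event is expressed through \<open>X j\<close>, so that independence of the
      messages applies to it.\<close>
    have B: "X j -` (X j ` ?B) \<inter> space M = ?B" using det by auto
    have "(\<lambda>\<omega>. (X i \<omega>, Y (T i) \<omega>)) -` {(X i \<omega>, Y (T i) \<omega>)} \<inter> space M = (X i -` {X i \<omega>} \<inter> space M) \<inter> ?B"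
      by auto
    then have "atom_prob (\<lambda>\<omega>. (X i \<omega>, Y (T i) \<omega>)) \<omega> = atom_prob (X i) \<omega> * atom_prob (Y (T i)) \<omega>"
      using prob_messages[OF ij, of "{X i \<omega>}" "X j ` ?B"] unfolding B by (simp add: atom_prob_def)
    with elim show ?case by simp
  qed
  then have "expectation (\<lambda>\<omega>. - log b (atom_prob (X i) \<omega>)) = expectation (\<lambda>\<omega>. 0)"
    using atom_prob_measurable[OF X] by (intro integral_cong_AE) (auto elim: eventually_mono)
  then show False
    using entropy_eq_expectation[OF X] message_entropy[OF ij(1)] by simp
qed

text \<open>Otherwise the symbol on \<open>q\<close> yields \<open>Y (T j)\<close>, hence
  \<open>X j\<close>, and together with \<open>X j\<close> also \<open>Y (T i)\<close>, hence
  \<open>X i\<close>. Its entropy would be 2, above the capacity 1.\<close>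

lemma reaches_own_sink_around_unit_edge:
  assumes ij: "i \<in> {1,2}" "j \<in> {1,2}" "i \<noteq> j" and q: "q \<in> arcs G" "c q = 1"
    and dom: "dominates q (T j)"
  shows "reaches (S i) {q} (T i)"
proof (rule ccontr)
  assume not: "\<not> ?thesis"
  have T: "T i \<in> arcs G" "T j \<in> arcs G" using T_arc ij by auto
  note Yq = symbol_discrete_variable[OF q(1)]
  note Ti = symbol_discrete_variable[OF T(1)] and Tj = symbol_discrete_variable[OF T(2)]
  note Xi = message_discrete_variable[OF ij(1)] and Xj = message_discrete_variable[OF ij(2)]
  have det_j: "Y (T j) \<omega>' = Y (T j) \<omega>" if "\<omega> \<in> space M" "\<omega>' \<in> space M" "Y q \<omega>' = Y q \<omega>" for \<omega> \<omega>'
    using that dom dominatesD by (intro symbol_determined[OF T(2), of _ _ "{q}"]) auto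
  have det_i: "Y (T i) \<omega>' = Y (T i) \<omega>"
    if "\<omega> \<in> space M" "\<omega>' \<in> space M" "Y q \<omega>' = Y q \<omega>" "X j \<omega>' = X j \<omega>" for \<omega> \<omega>'
    using that not ij by (intro symbol_determined[OF T(1), of _ _ "{q}"]) auto
  have "AE \<omega> in M. message_information \<omega> \<le> - log b (atom_prob (Y q) \<omega>)"
    using AE_decodable[OF ij(1)] AE_decodable[OF ij(2)] AE_atom_prob_pos[OF Yq] AE_space
  proof eventually_elim
    case (elim \<omega>)
    let ?Xi = "X i -` {X i \<omega>} \<inter> space M" and ?Xj = "X j -` {X j \<omega>} \<inter> space M"
    \<comment> \<open>The outcomes where some sink symbol agrees with that at \<omega> but the
      message differs. Off this null set, equal \<open>Y q\<close> gives equal \<open>X j\<close> by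
      \<open>det_j\<close>, and then equal \<open>X i\<close> by \<open>det_i\<close>.\<close>
    let ?N = "((Y (T i) -` {Y (T i) \<omega>} \<inter> space M) - ?Xi) \<union> ((Y (T j) -` {Y (T j) \<omega>} \<inter> space M) - ?Xj)"
    have N: "?N \<in> null_sets M"
      using decoding_error_null[OF ij(1) elim(1)] decoding_error_null[OF ij(2) elim(2)] by (rule null_sets.Un)
    have ev: "?Xi \<inter> ?Xj \<in> events"
      using discrete_variable_sets[OF Xi] discrete_variable_sets[OF Xj] by auto
    have "Y q -` {Y q \<omega>} \<inter> space M \<subseteq> (?Xi \<inter> ?Xj) \<union> ?N"
      using det_i[OF elim(4)] det_j[OF elim(4)] by auto
    then have "atom_prob (Y q) \<omega> \<le> prob ((?Xi \<inter> ?Xj) \<union> ?N)"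
      unfolding atom_prob_def using ev N by (intro finite_measure_mono) auto
    also have "\<dots> = prob (?Xi \<inter> ?Xj)"
      using ev N by (rule measure_Un_null_set)
    also have "\<dots> = atom_prob (X 1) \<omega> * atom_prob (X 2) \<omega>"
      using atom_prob_messages[OF ij] ij by auto
    finally show ?case
      using elim(3) b_gt_1 by (simp add: message_information_def log_le_cancel_iff)
  qed
  moreover have "AE \<omega> in M. - log b (atom_prob (Y q) \<omega>) \<le> message_information \<omega>"
    by (rule information_le_message_information[OF Yq])
      (rule symbol_determined_by_messages[OF q(1)], auto)
  ultimately have "AE \<omega> in M. - log b (atom_prob (Y q) \<omega>) = message_information \<omega>"
    by (auto elim: eventually_elim2)
  then have "expectation (\<lambda>\<omega>. - log b (atom_prob (Y q) \<omega>)) = expectation message_information"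
    using atom_prob_measurable[OF Yq] integrable_message_information
    by (intro integral_cong_AE) auto
  then show False
    using edge_capacity[OF q(1)] q(2) entropy_eq_expectation[OF Yq] expectation_message_information
    by simp
qed

text \<open>For the auxiliary edges this comes from the solution itself: \<open>S i\<close> carries
  entropy 1, so its integer capacity is positive, and \<open>T i\<close> has the same
  capacity.\<close>

lemma capacity_pos: "e \<in> arcs G \<Longrightarrow> c e \<ge> 1"
proof -
  have "c (S i) \<ge> 1 \<and> c (T i) \<ge> 1" if i: "i \<in> {1,2}" for i
  proof -
    have S: "S i \<in> arcs G" using S_arc[OF i] by blast
    have "\<H>(Y (S i)) = expectation (\<lambda>\<omega>. - log b (atom_prob (X i) \<omega>))"
      unfolding entropy_eq_expectation[OF symbol_discrete_variable[OF S]]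
      using source_symbol[OF i]
      by (intro Bochner_Integration.integral_cong[OF refl] arg_cong[where f = "\<lambda>p. - log b p"] atom_prob_cong) auto
    then have "\<H>(Y (S i)) = 1"
      using entropy_eq_expectation[OF message_discrete_variable[OF i]] message_entropy[OF i] by simp
    with edge_capacity[OF S] show ?thesis
      using capacity_S[OF i] capacity_T[OF i] by simp
  qed
  then show "e \<in> arcs G \<Longrightarrow> c e \<ge> 1"
    using capacity_other[of e] by fastforce
qed

lemma bottlenecks_exist: "\<exists>r. bottlenecks G s t S T c r"
proof -
  have "\<exists>q\<in>arcs G. (\<forall>j\<in>{1,2}. i \<noteq> j \<longrightarrow> reaches (S j) {q} (T j)) \<and>
      (q \<noteq> S i \<longrightarrow> (\<forall>q'. \<not> properly_dominates q' q)) \<and>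
      (properly_dominates q (T i) \<or> q = S i \<and> (\<forall>q. \<not> properly_dominates q (T i)))"
    if i: "i \<in> {1,2}" for i
  proof (cases "\<exists>q. properly_dominates q (T i)")
    \<comment> \<open>Without a proper dominator the default is \<open>S i\<close>; it separates
      nothing of the other pair by \<open>reaches_own_sink\<close>.\<close>
    case False
    then show ?thesis
      using S_arc[OF i] reaches_own_sink[OF _ i] by (intro bexI[of _ "S i"]) auto
  next
    case True
    have T: "T i \<in> arcs G" "T i \<noteq> S 1" "T i \<noteq> S 2"
      using T_arc[OF i] S_neq_T[of 1 i] S_neq_T[of 2 i] i by auto
    obtain q where q: "properly_dominates q (T i)"
      and early: "\<And>q'. q \<noteq> S 1 \<Longrightarrow> q \<noteq> S 2 \<Longrightarrow> \<not> properly_dominates q' q"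
      using True earliest_dominator[OF T] by metis
    \<comment> \<open>A proper dominator has a successor and so is no sink edge. As it is not the
      other source either, it is \<open>S i\<close> or has capacity 1.\<close>
    have arc: "q \<in> arcs G" "q \<noteq> T 1" "q \<noteq> T 2"
      using arc_rel_trancl_arcs[OF properly_dominates_arc_rel[OF T q]] by auto
    note dom = dominates_if_preds[OF q T(2,3)]
    have not_S: "q \<noteq> S j" if "j \<in> {1,2}" "i \<noteq> j" for j
      using dominatesD[OF dom i] reaches_own_sink[OF i that] by auto
    show ?thesis
    proof (intro bexI[of _ q] conjI ballI impI allI disjI1)
      fix j assume j: "j \<in> {1,2::nat}" "i \<noteq> j"
      show "reaches (S j) {q} (T j)"
      proof (cases "q = S i")
        case True
        then show ?thesis using reaches_own_sink[OF j(1) i] j(2) by auto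
      next
        case False
        then have "q \<noteq> S 1" "q \<noteq> S 2" using not_S[of 1] not_S[of 2] i by auto
        then have "c q = 1" using capacity_other[of q] arc by blast
        with arc(1) dom show ?thesis
          using reaches_own_sink_around_unit_edge[OF j(1) i] j(2) by blast
      qed
    next
      fix q' assume "q \<noteq> S i"
      then have "q \<noteq> S 1" "q \<noteq> S 2" using not_S[of 1] not_S[of 2] i by auto
      then show "\<not> properly_dominates q' q" by (rule early)
    qed (use q arc in auto)
  qed
  then obtain r where "\<forall>i\<in>{1,2}. r i \<in> arcs G \<and> (\<forall>j\<in>{1,2}. i \<noteq> j \<longrightarrow> reaches (S j) {r i} (T j)) \<and>
      (r i \<noteq> S i \<longrightarrow> (\<forall>q'. \<not> properly_dominates q' (r i))) \<and>
      (properly_dominates (r i) (T i) \<or> r i = S i \<and> (\<forall>q. \<not> properly_dominates q (T i)))"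
    by metis
  then have "bottlenecks G s t S T c r"
    by unfold_locales auto
  then show ?thesis by blast
qed

end

subsection \<open>A linear code over a prime field\<close>

text \<open>Cramer's rule, with \<open>w\<close> below as the inverse of the determinant modulo
  \<open>p\<close>: two independent combinations of the messages yield any third one.\<close>

lemma cramer_mod_prime:
  fixes p :: int
  assumes "prime p" "\<not> p dvd a\<^sub>1 * b\<^sub>2 - a\<^sub>2 * b\<^sub>1"
  shows "\<exists>u v. \<forall>x y. (u * (a\<^sub>1 * x + b\<^sub>1 * y) + v * (a\<^sub>2 * x + b\<^sub>2 * y)) mod p = (a * x + b * y) mod p"
proof -
  define d where "d = a\<^sub>1 * b\<^sub>2 - a\<^sub>2 * b\<^sub>1"
  have "coprime d p"
    using assms prime_imp_coprime[of p d] by (simp add: d_def coprime_commute)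
  then obtain w where w: "[d * w = 1] (mod p)"
    using cong_solve_coprime_int by blast
  define u where "u = w * (a * b\<^sub>2 - a\<^sub>2 * b)"
  define v where "v = w * (a\<^sub>1 * b - a * b\<^sub>1)"
  have "[u * (a\<^sub>1 * x + b\<^sub>1 * y) + v * (a\<^sub>2 * x + b\<^sub>2 * y) = a * x + b * y] (mod p)" for x y
  proof -
    have "u * (a\<^sub>1 * x + b\<^sub>1 * y) + v * (a\<^sub>2 * x + b\<^sub>2 * y) = d * w * (a * x + b * y)"
      by (simp add: u_def v_def d_def algebra_simps)
    moreover have "[d * w * (a * x + b * y) = 1 * (a * x + b * y)] (mod p)"
      using w by (rule cong_scalar_right)
    ultimately show ?thesis by simp
  qed
  then show ?thesis unfolding cong_def by blast
qed

lemma mod_linear_combination: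
  "(u * (x mod p) + v * (y mod p)) mod p = (u * x + v * y) mod (p :: int)"
  by (rule mod_add_cong) (rule mod_mult_right_eq)+

lemma linear_function_residue_ring:
  assumes "p > 1" and "e\<^sub>1 \<in> I" "e\<^sub>2 \<in> I"
  shows "linear_function (residue_ring p) I (\<lambda>z. (u * z e\<^sub>1 + v * z e\<^sub>2) mod p)"
proof -
  have "(u * ((x\<^sub>1 + y\<^sub>1) mod p) + v * ((x\<^sub>2 + y\<^sub>2) mod p)) mod p =
      ((u * x\<^sub>1 + v * x\<^sub>2) mod p + (u * y\<^sub>1 + v * y\<^sub>2) mod p) mod p" for x\<^sub>1 x\<^sub>2 y\<^sub>1 y\<^sub>2
    unfolding mod_linear_combination mod_add_eq by (simp add: algebra_simps)
  moreover have "(u * (a * x\<^sub>1 mod p) + v * (a * x\<^sub>2 mod p)) mod p = a * ((u * x\<^sub>1 + v * x\<^sub>2) mod p) mod p"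
    for a x\<^sub>1 x\<^sub>2
    unfolding mod_linear_combination mod_mult_right_eq by (simp add: algebra_simps)
  ultimately show ?thesis
    using assms by (simp add: linear_function_def residue_ring_def)
qed

section \<open>Uniform independent messages over a prime field\<close>

locale residue_messages =
  fixes p :: nat
  assumes prime_p: "prime p"
begin

definition R :: "int set" where
  "R = {0..int p - 1}"

definition M :: "(int \<times> int) measure" where
  "M = uniform_count_measure (R \<times> R)"

definition X :: "nat \<Rightarrow> int \<times> int \<Rightarrow> int" where
  "X i = (if i = 1 then fst else snd)"

lemma finite_R [simp]: "finite R" and card_R [simp]: "card R = p"
  by (auto simp: R_def)

lemma R_nonempty [simp]: "R \<noteq> {}"
  using prime_gt_1_nat[OF prime_p] by (simp add: R_def)

lemma space_M [simp]: "space M = R \<times> R" and sets_M [simp]: "sets M = Pow (R \<times> R)"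
  by (auto simp: M_def space_uniform_count_measure sets_uniform_count_measure)

sublocale information_space M "real p"
proof (rule information_space.intro)
  show "prob_space M"
    unfolding M_def by (rule prob_space_uniform_count_measure) auto
  show "information_space_axioms (real p)"
    using prime_gt_1_nat[OF prime_p] by unfold_locales auto
qed

lemma prob_M: "A \<subseteq> R \<times> R \<Longrightarrow> prob A = card A / (real p)\<^sup>2"
  by (simp add: M_def measure_uniform_count_measure card_cartesian_product power2_eq_square)

lemma random_variable_M: "random_variable (count_space UNIV) Z"
  by (auto simp: measurable_def)

lemma discrete_variable_M: "discrete_variable Z"
  using random_variable_M by (auto simp: discrete_variable_def)

lemma X_in_R: "\<omega> \<in> R \<times> R \<Longrightarrow> X i \<omega> \<in> R"
  by (auto simp: X_def)

lemma prob_X: "a \<in> R \<Longrightarrow> prob (X i -` {a} \<inter> space M) = 1 / real p"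
proof -
  assume "a \<in> R"
  then have "X i -` {a} \<inter> space M = (if i = 1 then {a} \<times> R else R \<times> {a})"
    by (auto simp: X_def)
  then show ?thesis
    using \<open>a \<in> R\<close>
    by (subst prob_M) (auto simp: card_cartesian_product power2_eq_square)
qed

lemma entropy_X: "entropy (real p) (count_space (X i ` space M)) (X i) = 1"
proof -
  have "atom_prob (X i) \<omega> = 1 / real p" if "\<omega> \<in> space M" for \<omega>
    using that prob_X X_in_R by (simp add: atom_prob_def)
  then have "entropy (real p) (count_space (X i ` space M)) (X i) = expectation (\<lambda>\<omega>. - log (real p) (1 / real p))"
    unfolding entropy_eq_expectation[OF discrete_variable_M]
    by (intro Bochner_Integration.integral_cong) auto
  also have "\<dots> = 1"
    using prime_gt_1_nat[OF prime_p] by (simp add: log_divide prob_space del: space_M)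
  finally show ?thesis .
qed

text \<open>At most \<open>p\<close> values occur and the logarithm has base \<open>p\<close>. Hence
  capacity 1 suffices for every symbol of the code.\<close>

lemma entropy_le_1:
  assumes "Z ` (R \<times> R) \<subseteq> R"
  shows "entropy (real p) (count_space (Z ` space M)) Z \<le> 1"
proof -
  have "simple_function M Z" by (auto simp: simple_function_def)
  then have "simple_distributed M Z (\<lambda>z. prob (Z -` {z} \<inter> space M))"
    by (rule simple_distributedI) auto
  then have "entropy (real p) (count_space (Z ` space M)) Z \<le> log (real p) (real (card (Z ` space M)))"
    by (rule entropy_le_card)
  also have "\<dots> \<le> log (real p) (real p)"
  proof -
    have "card (Z ` space M) \<le> p"
      using card_mono[OF finite_R assms] by simp
    moreover have "Z ` space M \<noteq> {}" by simp
    then have "0 < card (Z ` space M)" by (simp only: card_gt_0_iff) simp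
    ultimately show ?thesis
      using prime_gt_1_nat[OF prime_p] by (subst log_le_cancel_iff) auto
  qed
  finally show ?thesis using prime_gt_1_nat[OF prime_p] by simp
qed

lemma conditional_entropy_self: "conditional_entropy (real p) (count_space (Z ` space M)) (count_space (Z ` space M)) Z Z = 0"
proof -
  have eq: "atom_prob (\<lambda>\<omega>. (Z \<omega>, Z \<omega>)) \<omega> = atom_prob Z \<omega>" if "\<omega> \<in> space M" for \<omega>
    using that by (intro atom_prob_cong) auto
  have "AE \<omega> in M. - log (real p) (atom_prob (\<lambda>\<omega>. (Z \<omega>, Z \<omega>)) \<omega> / atom_prob Z \<omega>) = 0"
    using AE_space AE_atom_prob_pos[OF discrete_variable_M, of Z] by eventually_elim (simp add: eq)
  then have "conditional_entropy (real p) (count_space (Z ` space M)) (count_space (Z ` space M)) Z Z = expectation (\<lambda>\<omega>. 0)"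
    unfolding conditional_entropy_eq_expectation[OF discrete_variable_M discrete_variable_M]
    by (intro integral_cong_AE) (auto simp: measurable_def)
  then show ?thesis by simp
qed

text \<open>Both the product of the marginals and the joint law live on a countable space, so it is
  enough to compare them on singletons.\<close>

lemma indep_X: "indep_var (count_space UNIV) (X 1) (count_space UNIV) (X 2)"
proof -
  have P: "count_space UNIV \<Otimes>\<^sub>M count_space UNIV = (count_space UNIV :: (int \<times> int) measure)"
    by (simp add: pair_measure_countable)
  have eq: "distr M (count_space UNIV) (X 1) \<Otimes>\<^sub>M distr M (count_space UNIV) (X 2) =
      distr M (count_space UNIV \<Otimes>\<^sub>M count_space UNIV) (\<lambda>\<omega>. (X 1 \<omega>, X 2 \<omega>))"
  proof (rule measure_eqI_countable[where A = UNIV])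
    interpret X2: prob_space "distr M (count_space UNIV) (X 2)"
      by (rule prob_space_distr[OF random_variable_M])
    fix z :: "int \<times> int"
    obtain a b where z: "z = (a, b)" by force
    have "emeasure (distr M (count_space UNIV) (X 1) \<Otimes>\<^sub>M distr M (count_space UNIV) (X 2)) ({a} \<times> {b}) =
        emeasure M (X 1 -` {a} \<inter> space M) * emeasure M (X 2 -` {b} \<inter> space M)"
      by (subst X2.emeasure_pair_measure_Times) (simp_all add: emeasure_distr random_variable_M del: space_M)
    also have "\<dots> = emeasure M ((\<lambda>\<omega>. (X 1 \<omega>, X 2 \<omega>)) -` {z} \<inter> space M)"
    proof (cases "a \<in> R \<and> b \<in> R")
      case True
      then have "(\<lambda>\<omega>. (X 1 \<omega>, X 2 \<omega>)) -` {z} \<inter> space M = {(a, b)}"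
        by (auto simp: X_def z)
      then show ?thesis
        using True
        by (simp add: emeasure_eq_measure prob_X prob_M power2_eq_square del: space_M flip: ennreal_mult)
    next
      case False
      then have "(\<lambda>\<omega>. (X 1 \<omega>, X 2 \<omega>)) -` {z} \<inter> space M = {}"
        and "X 1 -` {a} \<inter> space M = {} \<or> X 2 -` {b} \<inter> space M = {}"
        by (auto simp: X_def z)
      then show ?thesis by (auto simp del: space_M)
    qed
    also have "\<dots> = emeasure (distr M (count_space UNIV \<Otimes>\<^sub>M count_space UNIV) (\<lambda>\<omega>. (X 1 \<omega>, X 2 \<omega>))) {z}"
      by (simp add: emeasure_distr P random_variable_M)
    finally show "emeasure (distr M (count_space UNIV) (X 1) \<Otimes>\<^sub>M distr M (count_space UNIV) (X 2)) {z} =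
        emeasure (distr M (count_space UNIV \<Otimes>\<^sub>M count_space UNIV) (\<lambda>\<omega>. (X 1 \<omega>, X 2 \<omega>))) {z}"
      by (simp add: z)
    show "sets (distr M (count_space UNIV) (X 1) \<Otimes>\<^sub>M distr M (count_space UNIV) (X 2)) = Pow UNIV"
      by (subst sets_pair_measure_cong[of _ "count_space UNIV" _ "count_space UNIV"])
        (simp_all only: sets_distr P sets_count_space)
  qed (auto simp: P)
  show ?thesis
    using random_variable_M eq unfolding indep_var_distribution_eq by blast
qed

lemma distr_X: "distr M (count_space R) (X i) = uniform_count_measure R"
proof (rule measure_eqI_countable[where A = R])
  fix a assume a: "a \<in> R"
  have "X i \<in> M \<rightarrow>\<^sub>M count_space R"
    using X_in_R by (auto simp: measurable_def)
  then have "emeasure (distr M (count_space R) (X i)) {a} = ennreal (1 / real p)"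
    using a prob_X by (simp add: emeasure_distr emeasure_eq_measure del: space_M)
  also have "\<dots> = emeasure (uniform_count_measure R) {a}"
    using a by (simp add: emeasure_uniform_count_measure)
  finally show "emeasure (distr M (count_space R) (X i)) {a} = emeasure (uniform_count_measure R) {a}" .
qed (auto simp: sets_uniform_count_measure countable_finite)

end

section \<open>Construction of the linear code\<close>

context bottlenecks
begin

text \<open>The determinants are nonzero integers of absolute value below \<open>p\<close>, hence
  nonzero modulo \<open>p\<close>.\<close>

lemma ex_directions:
  assumes "card (arcs G) + 1 < p"
  obtains \<alpha> \<beta> :: "'b \<Rightarrow> int" where
    "\<alpha> (S 1) = 1" "\<beta> (S 1) = 0" "\<alpha> (S 2) = 0" "\<beta> (S 2) = 1"
    "\<And>k l. k \<in> arcs G \<Longrightarrow> l \<in> arcs G \<Longrightarrow> k \<noteq> l \<Longrightarrow> \<not> int p dvd \<alpha> k * \<beta> l - \<alpha> l * \<beta> k"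
proof -
  obtain h :: "'b \<Rightarrow> nat" where h: "bij_betw h (arcs G) {0..<card (arcs G)}"
    using ex_bij_betw_finite_nat[OF finite_arcs] by blast
  define \<alpha> where "\<alpha> k = (if k = S 2 then 0 else 1 :: int)" for k
  \<comment> \<open>Ordinary edges get the vectors (1, \<open>h k + 1\<close>); the added 1 keeps
    them apart from the vector (1, 0) of \<open>S 1\<close>.\<close>
  define \<beta> where "\<beta> k = (if k = S 1 then 0 else if k = S 2 then 1 else int (h k) + 1)" for k
  have range: "h k < card (arcs G)" if "k \<in> arcs G" for k
    using h that by (auto simp: bij_betw_def)
  have small: "\<not> int p dvd z" if "z \<noteq> 0" "\<bar>z\<bar> < int p" for z
    using that zdvd_not_zless[of "\<bar>z\<bar>" "int p"] by auto
  have "\<not> int p dvd \<alpha> k * \<beta> l - \<alpha> l * \<beta> k"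
    if kl: "k \<in> arcs G" "l \<in> arcs G" "k \<noteq> l" for k l
  proof (rule small)
    have "h k \<noteq> h l"
      using h kl by (auto simp: bij_betw_def inj_on_def)
    then show "\<alpha> k * \<beta> l - \<alpha> l * \<beta> k \<noteq> 0"
      using kl S_neq by (auto simp: \<alpha>_def \<beta>_def)
    show "\<bar>\<alpha> k * \<beta> l - \<alpha> l * \<beta> k\<bar> < int p"
      using range[OF kl(1)] range[OF kl(2)] assms by (auto simp: \<alpha>_def \<beta>_def)
  qed
  then show thesis
    using S_neq by (intro that[of \<alpha> \<beta>]) (auto simp: \<alpha>_def \<beta>_def)
qed

lemma linear_solution_exists:
  assumes capacity: "\<And>e. e \<in> arcs G \<Longrightarrow> c e \<ge> 1"
  shows "\<exists>(M :: (int \<times> int) measure) b (X :: nat \<Rightarrow> int \<times> int \<Rightarrow> int) f Y (F :: int ring).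
    linear_network_coding_solution G s t S T c M b X f Y F"
proof -
  obtain p where p: "prime p" "card (arcs G) + 1 < p"
    using bigger_prime[of "card (arcs G) + 1"] by blast
  interpret U: residue_messages p by standard (fact p)
  interpret residues_prime p "residue_ring (int p)"
    by (rule residues_prime.intro) (use p in auto)
  obtain \<alpha> \<beta> :: "'b \<Rightarrow> int" where S12: "\<alpha> (S 1) = 1" "\<beta> (S 1) = 0" "\<alpha> (S 2) = 0" "\<beta> (S 2) = 1"
    and indep: "\<And>k l. k \<in> arcs G \<Longrightarrow> l \<in> arcs G \<Longrightarrow> k \<noteq> l \<Longrightarrow> \<not> int p dvd \<alpha> k * \<beta> l - \<alpha> l * \<beta> k"
    using ex_directions[OF p(2)] by blast
  \<comment> \<open>The symbols are fixed first, as global combinations of the messages; local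
    encoding functions producing them are found afterwards.\<close>
  define Y where "Y e \<omega> = (\<alpha> (label e) * fst \<omega> + \<beta> (label e) * snd \<omega>) mod int p" for e and \<omega> :: "int \<times> int"
  have "\<exists>e\<^sub>1\<in>in_arcs G (tail G e). \<exists>e\<^sub>2\<in>in_arcs G (tail G e). \<exists>u v. \<forall>\<omega>.
      (u * Y e\<^sub>1 \<omega> + v * Y e\<^sub>2 \<omega>) mod int p = Y e \<omega>"
    if e: "e \<in> arcs G - {S 1, S 2}" for e
  proof -
    obtain e\<^sub>1 e\<^sub>2 where in_e: "e\<^sub>1 \<in> in_arcs G (tail G e)" "e\<^sub>2 \<in> in_arcs G (tail G e)"
      and "label e\<^sub>1 = label e \<or> label e\<^sub>1 \<noteq> label e\<^sub>2"
      using encodable_label[of e] e by blast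
    from this(3) have "\<exists>u v. \<forall>\<omega>. (u * Y e\<^sub>1 \<omega> + v * Y e\<^sub>2 \<omega>) mod int p = Y e \<omega>"
    proof
      assume "label e\<^sub>1 = label e"
      then have "\<forall>\<omega>. (1 * Y e\<^sub>1 \<omega> + 0 * Y e\<^sub>2 \<omega>) mod int p = Y e \<omega>"
        by (simp add: Y_def)
      then show ?thesis by blast
    next
      assume "label e\<^sub>1 \<noteq> label e\<^sub>2"
      then have "\<not> int p dvd \<alpha> (label e\<^sub>1) * \<beta> (label e\<^sub>2) - \<alpha> (label e\<^sub>2) * \<beta> (label e\<^sub>1)"
        using in_e label_arc by (intro indep) auto
      then obtain u v where "\<forall>x y. (u * (\<alpha> (label e\<^sub>1) * x + \<beta> (label e\<^sub>1) * y) +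
          v * (\<alpha> (label e\<^sub>2) * x + \<beta> (label e\<^sub>2) * y)) mod int p =
          (\<alpha> (label e) * x + \<beta> (label e) * y) mod int p"
        using cramer_mod_prime[of "int p" "\<alpha> (label e\<^sub>1)" "\<beta> (label e\<^sub>2)" "\<alpha> (label e\<^sub>2)" "\<beta> (label e\<^sub>1)"] p(1)
        by (metis prime_nat_int_transfer)
      then have "\<forall>\<omega>. (u * Y e\<^sub>1 \<omega> + v * Y e\<^sub>2 \<omega>) mod int p = Y e \<omega>"
        by (simp add: Y_def mod_linear_combination)
      then show ?thesis by blast
    qed
    with in_e show ?thesis by blast
  qed
  then obtain e\<^sub>1 e\<^sub>2 u v where code: "\<And>e. e \<in> arcs G - {S 1, S 2} \<Longrightarrow>
      e\<^sub>1 e \<in> in_arcs G (tail G e) \<and> e\<^sub>2 e \<in> in_arcs G (tail G e) \<and>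
      (\<forall>\<omega>. (u e * Y (e\<^sub>1 e) \<omega> + v e * Y (e\<^sub>2 e) \<omega>) mod int p = Y e \<omega>)"
    by metis
  define f where "f e z = (u e * z (e\<^sub>1 e) + v e * z (e\<^sub>2 e)) mod int p" for e and z :: "'b \<Rightarrow> int"
  have carrier: "carrier (residue_ring (int p)) = U.R"
    by (simp add: residue_ring_def U.R_def)
  have Y_R: "Y e \<omega> \<in> U.R" for e \<omega>
    using prime_gt_1_nat[OF p(1)] by (auto simp: Y_def U.R_def)
  have "linear_network_coding_solution G s t S T c U.M (real p) U.X f Y (residue_ring (int p))"
  proof (intro linear_network_coding_solution.intro network_coding_solution.intro network_code.intro
      network_code_axioms.intro network_coding_solution_axioms.intro
      linear_network_coding_solution_axioms.intro)
    fix i :: nat assume i: "i \<in> {1, 2}"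
    show "U.random_variable (count_space UNIV) (U.X i)" "countable (U.X i ` space U.M)"
      using U.discrete_variable_M by (auto simp: U.discrete_variable_def)
    show "U.entropy (real p) (count_space (U.X i ` space U.M)) (U.X i) = 1"
      by (rule U.entropy_X)
    \<comment> \<open>Decoding is trivial: both edges have the label \<open>S i\<close>, so the sink
      edge carries the message itself.\<close>
    have "Y (S i) = Y (T i)"
      using label_S[OF i] label_T[OF i] by (simp add: Y_def fun_eq_iff)
    then show "U.conditional_entropy (real p) (count_space (Y (S i) ` space U.M))
        (count_space (Y (T i) ` space U.M)) (Y (S i)) (Y (T i)) = 0"
      using U.conditional_entropy_self by simp
    show "distr U.M (count_space (carrier (residue_ring (int p)))) (U.X i) =
        uniform_count_measure (carrier (residue_ring (int p)))"
      unfolding carrier by (rule U.distr_X)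
    fix \<omega> assume "\<omega> \<in> space U.M"
    then show "Y (S i) \<omega> = U.X i \<omega>"
      using i S12 label_S[OF i] by (auto simp: Y_def U.X_def U.R_def)
  next
    fix e \<omega> assume "e \<in> arcs G - {S 1, S 2}" "\<omega> \<in> space U.M"
    then show "Y e \<omega> = f e (\<lambda>e'\<in>in_arcs G (tail G e). Y e' \<omega>)"
      using code[of e] by (cases \<omega>) (simp add: f_def)
  next
    fix e assume "e \<in> arcs G"
    then show "U.entropy (real p) (count_space (Y e ` space U.M)) (Y e) \<le> real (c e)"
      using U.entropy_le_1[of "Y e"] Y_R capacity[of e] by force
  next
    fix e assume "e \<in> arcs G - {S 1, S 2}"
    then show "linear_function (residue_ring (int p)) (in_arcs G (tail G e)) (f e)"
      unfolding f_def[abs_def] using code[of e] prime_gt_1_nat[OF p(1)]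
      by (intro linear_function_residue_ring) auto
  next
    show "real p = real (card (carrier (residue_ring (int p))))"
      unfolding carrier by simp
  qed (use U.indep_X Y_R carrier is_field two_unicast_network_axioms U.information_space_axioms in auto)
  then show ?thesis by blast
qed

end

theorem corollary4p6:
  fixes G :: "('v, 'e) pre_digraph"
    and s t :: "nat \<Rightarrow> 'v" and S T :: "nat \<Rightarrow> 'e" and c :: "'e \<Rightarrow> nat"
  assumes "two_unicast_network G s t S T c"
    and "\<exists>(M :: 'w measure) b (X :: nat \<Rightarrow> 'w \<Rightarrow> 'x) f Y.
           network_coding_solution G s t S T c M b X f Y"
  shows "\<exists>(M :: (int \<times> int) measure) b (X :: nat \<Rightarrow> int \<times> int \<Rightarrow> int) f Y (F :: int ring).
           linear_network_coding_solution G s t S T c M b X f Y F"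
proof -
  obtain M :: "'w measure" and b and X :: "nat \<Rightarrow> 'w \<Rightarrow> 'x" and f Y
    where "network_coding_solution G s t S T c M b X f Y"
    using assms(2) by blast
  then interpret network_coding_solution G s t S T c M b X f Y .
  obtain r where "bottlenecks G s t S T c r"
    using bottlenecks_exist by blast
  then show ?thesis
    using capacity_pos by (rule bottlenecks.linear_solution_exists)
qed

end
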